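(* Let $\mathcal{C}$ be a class of open sets in $\mathbb{R}^d$ with diameter at most $D$ and volume at least $v>0$. Let $\pi(n)=\pi^*_{\mathcal{C}}(n)$ denote the dual shatter function of $\mathcal{C}$, and let $B^d$ denote the unit ball in $\mathbb{R}^d$. Then, for every positive integer $m$, any $m$-fold covering of $\mathbb{R}^d$ with members of $\mathcal{C}$ splits into two coverings, provided that no point of the space is covered more than $$\frac{v}{(2D)^d\,\mathrm{Vol}\,B^d}\,\pi^{-1}(2^{m-3})$$ times, where $\mathrm{Vol}\,B^d$ is the volume of $B^d$.
   Context: Given $n$ members $C_1,\ldots,C_n$ of $\mathcal{C}$, assign to each point $x\in\mathbb{R}^d$ its characteristic vector $c(x)=(c_1(x),\ldots,c_n(x))$, where $c_i(x)=1$ if $x\in C_i$ and $c_i(x)=0$ otherwise. The dual shatter function $\pi^*_{\mathcal{C}}(n)$ is the maximum, over all $n$-tuples $C_1,\ldots,C_n\in\mathcal{C}$, of the number of distinct characteristic vectors $c(x)$, $x\in\mathbb{R}^d$ (with $\pi^*_{\mathcal{C}}(0)=1$). For a real $z$, $\pi^{-1}(z)$ denotes the largest integer $n\ge 0$ with $\pi(n)\le z$ (and $\pi^{-1}(z)=0$ if there is no such $n$). A family of sets is an $m$-fold covering of $\mathbb{R}^d$ if every point of $\mathbb{R}^d$ belongs to at least $m$ of its members; a $1$-fold covering is called a covering. An $m$-fold covering splits into two coverings if it can be partitioned into two subfamilies, each of which is a covering of $\mathbb{R}^d$. A point is covered $t$ times if it belongs to exactly $t$ members of the family. *)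

theory Defs
  imports "HOL-Analysis.Analysis"
begin

definition char_vector :: "'a set list \<Rightarrow> 'a \<Rightarrow> nat list" where
  "char_vector Cs x = map (\<lambda>C. indicator C x) Cs"

(* Repetitions in the tuple are allowed.  The maximum is over a set of numbers bounded by 2^n;
   that set is empty only if the class is empty and n > 0, in which case Max is unspecified. *)
definition dual_shatter :: "'a set set \<Rightarrow> nat \<Rightarrow> nat" where
  "dual_shatter \<C> n =
     Max {card (range (char_vector Cs)) | Cs. length Cs = n \<and> set Cs \<subseteq> \<C>}"

lemma dual_shatter_0: "dual_shatter \<C> 0 = 1"
proof -
  have "{card (range (char_vector Cs)) | Cs. length Cs = 0 \<and> set Cs \<subseteq> \<C>} = {1}"
    by (auto simp: char_vector_def)
  then show ?thesis
    by (simp add: dual_shatter_def)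
qed

(* The set below can be infinite only if p does not tend to infinity.  The dual shatter function
   of an infinite class does tend to infinity, and a class of bounded sets whose members cover
   Euclidean space is infinite. *)
definition shatter_inverse :: "(nat \<Rightarrow> nat) \<Rightarrow> real \<Rightarrow> nat" where
  "shatter_inverse p z =
     (if \<exists>n. real (p n) \<le> z then Max {n. real (p n) \<le> z} else 0)"

(* A family is indexed by a set I, so the same set may occur in it several times.
   card is 0 on infinite sets, hence the separate treatment of points lying in infinitely many
   members. *)
definition fold_covering :: "nat \<Rightarrow> 'i set \<Rightarrow> ('i \<Rightarrow> 'a set) \<Rightarrow> bool" where
  "fold_covering m I F \<longleftrightarrow>
     (\<forall>x. infinite {i \<in> I. x \<in> F i} \<or> m \<le> card {i \<in> I. x \<in> F i})"

abbreviation covering :: "'i set \<Rightarrow> ('i \<Rightarrow> 'a set) \<Rightarrow> bool" where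
  "covering \<equiv> fold_covering 1"

definition covered_more_than :: "real \<Rightarrow> 'i set \<Rightarrow> ('i \<Rightarrow> 'a set) \<Rightarrow> 'a \<Rightarrow> bool" where
  "covered_more_than t I F x \<longleftrightarrow>
     infinite {i \<in> I. x \<in> F i} \<or> t < real (card {i \<in> I. x \<in> F i})"

definition splits_into_two_coverings :: "'i set \<Rightarrow> ('i \<Rightarrow> 'a set) \<Rightarrow> bool" where
  "splits_into_two_coverings I F \<longleftrightarrow>
     (\<exists>I1 I2. I1 \<union> I2 = I \<and> I1 \<inter> I2 = {} \<and> covering I1 F \<and> covering I2 F)"

end

theory Submission
  imports Defs
begin

text \<open>
  Colour the members of the family red and blue independently with probability \<open>1/2\<close>. The colouring
  splits the family into two coverings unless, for some point \<open>x\<close>, all members containing \<open>x\<close>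
  receive the same colour. Such a bad event has probability at most \<open>2 / 2 ^ m\<close>, and it depends only
  on the set \<open>E x\<close> of indices of the members that contain \<open>x\<close>. The question is therefore whether the
  hypergraph whose vertices are the members and whose edges are the sets \<open>E x\<close> is two-colourable, and
  the symmetric Lovasz local lemma answers it as soon as every edge meets at most \<open>2 ^ (m - 3)\<close> edges,
  itself included.

  This bound comes from packing. If \<open>E x\<close> and \<open>E y\<close> meet, then \<open>x\<close> and \<open>y\<close> lie in a common member,
  so \<open>dist x y \<le> D\<close> and every member containing \<open>y\<close> lies in the ball of radius \<open>2 * D\<close> about \<open>x\<close>.
  Those members have volume at least \<open>v\<close> each and cover no point too often, so comparing volumes shows
  that there are at most \<open>N\<close> of them, where \<open>N\<close> is the value of the inverse shatter function at
  \<open>2 ^ (m - 3)\<close>. Since \<open>E y\<close> can be read off from the characteristic vector of \<open>y\<close> with respect to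
  these members, the number of edges \<open>E y\<close> meeting \<open>E x\<close> is at most \<open>dual_shatter \<C> N\<close>, which is at
  most \<open>2 ^ (m - 3)\<close>.

  The local lemma is proved in counting form for finite hypergraphs
  (\<open>finite_hypergraph_two_colourable\<close>). All edges being finite, Tychonoff's theorem then gives the
  infinite case (\<open>two_colourable_compactness\<close>).
\<close>

section \<open>Two-colourings of hypergraphs\<close>

text \<open>
  A two-colouring of the vertices is represented by the set \<open>S\<close> of vertices of the first colour.
\<close>

definition monochromatic :: "'i set \<Rightarrow> 'i set \<Rightarrow> bool" where
  "monochromatic S e \<longleftrightarrow> e \<subseteq> S \<or> e \<inter> S = {}"

definition proper_colourings :: "'i set \<Rightarrow> 'i set set \<Rightarrow> 'i set set" where
  "proper_colourings V T = {S \<in> Pow V. \<forall>f\<in>T. \<not> monochromatic S f}"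

definition spoilt_by :: "'i set \<Rightarrow> 'i set \<Rightarrow> 'i set set \<Rightarrow> 'i set set" where
  "spoilt_by e V T = {S \<in> proper_colourings V T. monochromatic S e}"

lemma finite_proper_colourings: "finite V \<Longrightarrow> finite (proper_colourings V T)"
  by (simp add: proper_colourings_def)

lemma finite_spoilt_by: "finite V \<Longrightarrow> finite (spoilt_by e V T)"
  by (simp add: spoilt_by_def finite_proper_colourings)

lemma spoilt_by_antimono: "T' \<subseteq> T \<Longrightarrow> spoilt_by e V T \<subseteq> spoilt_by e V T'"
  by (auto simp: spoilt_by_def proper_colourings_def)

text \<open>
  Independence: when no edge of \<open>T\<close> meets \<open>e\<close>, the colouring of \<open>e\<close> has no effect on whether \<open>T\<close> is
  properly coloured. So every proper colouring of the rest extends to \<open>e\<close> in all \<open>2 ^ card e\<close> ways, of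
  which exactly two make \<open>e\<close> monochromatic.
\<close>

lemma card_spoilt_by_disjoint:
  assumes "finite V" "e \<subseteq> V" "e \<noteq> {}" and disj: "\<And>f. f \<in> T \<Longrightarrow> f \<inter> e = {}"
  shows "2 ^ card e * card (spoilt_by e V T) = 2 * card (proper_colourings V T)"
proof -
  define G where "G = proper_colourings (V - e) T"
  define join where "join = (\<lambda>(A, S). A \<union> S :: 'a set)"
  have G_sub: "S \<subseteq> V - e" if "S \<in> G" for S
    using that by (auto simp: G_def proper_colourings_def)
  have inj: "inj_on join (Pow e \<times> G)"
  proof (rule inj_onI, clarify)
    fix A S A' S'
    assume *: "A \<subseteq> e" "A' \<subseteq> e" "S \<in> G" "S' \<in> G" "join (A, S) = join (A', S')"
    have "A = join (A, S) \<inter> e" "A' = join (A', S') \<inter> e" "S = join (A, S) - e" "S' = join (A', S') - e"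
      using * G_sub[of S] G_sub[of S'] by (auto simp: join_def)
    then show "A = A' \<and> S = S'" using * by metis
  qed
  have mono_iff: "monochromatic (A \<union> S) f \<longleftrightarrow> monochromatic S f" if "A \<subseteq> e" "f \<in> T" for A S f
    using disj[OF that(2)] that(1) by (auto simp: monochromatic_def)
  have join_proper: "join (A, S) \<in> proper_colourings V T" if "A \<subseteq> e" "S \<in> G" for A S
    using that mono_iff[OF that(1)] \<open>e \<subseteq> V\<close>
    by (auto simp: join_def G_def proper_colourings_def)
  have split: "S - e \<in> G \<and> S = join (S \<inter> e, S - e)" if "S \<in> proper_colourings V T" for S
  proof -
    have "S = (S \<inter> e) \<union> (S - e)" by auto
    then have "monochromatic (S - e) f \<longleftrightarrow> monochromatic S f" if "f \<in> T" for f
      using mono_iff[of "S \<inter> e" f "S - e"] that by simp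
    then show ?thesis
      using that by (auto simp: G_def proper_colourings_def join_def)
  qed
  have proper_eq: "proper_colourings V T = join ` (Pow e \<times> G)"
  proof (intro equalityI subsetI)
    fix S assume "S \<in> proper_colourings V T"
    then show "S \<in> join ` (Pow e \<times> G)"
      using split[of S] by (intro image_eqI[of _ _ "(S \<inter> e, S - e)"]) auto
  qed (use join_proper in auto)
  have spoilt_eq: "spoilt_by e V T = join ` ({e, {}} \<times> G)"
  proof (intro equalityI subsetI)
    fix S assume S: "S \<in> spoilt_by e V T"
    then have "S \<inter> e \<in> {e, {}}" by (auto simp: spoilt_by_def monochromatic_def)
    then show "S \<in> join ` ({e, {}} \<times> G)"
      using split[of S] S by (intro image_eqI[of _ _ "(S \<inter> e, S - e)"]) (auto simp: spoilt_by_def)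
  next
    fix S assume "S \<in> join ` ({e, {}} \<times> G)"
    then obtain A U where AU: "A \<in> {e, {}}" "U \<in> G" "S = join (A, U)" by auto
    then have "monochromatic S e" using G_sub[of U] by (auto simp: monochromatic_def join_def)
    then show "S \<in> spoilt_by e V T" using AU join_proper[of A U] by (auto simp: spoilt_by_def)
  qed
  have fe: "finite e" using assms finite_subset by blast
  have "card (proper_colourings V T) = 2 ^ card e * card G"
    unfolding proper_eq using card_image[OF inj] fe
    by (simp add: card_cartesian_product card_Pow)
  moreover have "card (spoilt_by e V T) = 2 * card G"
  proof -
    have "inj_on join ({e, {}} \<times> G)" by (rule inj_on_subset[OF inj]) auto
    then show ?thesis
      unfolding spoilt_eq using \<open>e \<noteq> {}\<close> by (simp add: card_image card_cartesian_product)
  qed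
  ultimately show ?thesis by simp
qed

text \<open>
  The inductive core of the local lemma: given that \<open>T\<close> is properly coloured, \<open>e\<close> is monochromatic
  with conditional probability at most \<open>4 / 2 ^ m\<close>, twice the unconditional bound. The edges of \<open>T\<close>
  far from \<open>e\<close> are independent of \<open>e\<close>. Adding the constraints of the near ones can at most double the
  conditional probability: by the induction hypothesis each of these at most \<open>2 ^ m / 8\<close> edges destroys
  at most a fraction \<open>4 / 2 ^ m\<close> of the colourings, hence together they destroy at most half.
\<close>

lemma spoilt_by_bound:
  fixes H :: "'i set set"
  assumes "finite V" "m \<ge> 1" "\<And>e. e \<in> H \<Longrightarrow> e \<subseteq> V" "\<And>e. e \<in> H \<Longrightarrow> m \<le> card e"
    and "\<And>e. e \<in> H \<Longrightarrow> 8 * card {f \<in> H. f \<inter> e \<noteq> {}} \<le> 2 ^ m"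
    and "T \<subseteq> H" "e \<in> H"
  shows "2 ^ m * card (spoilt_by e V T) \<le> 4 * card (proper_colourings V T)"
  using assms(6,7)
proof (induction "card T" arbitrary: T e rule: less_induct)
  case less
  have finH: "finite H" using assms(1,3) by (meson PowI finite_Pow_iff finite_subset subsetI)
  then have finT: "finite T" using less.prems finite_subset by blast
  define Far where "Far = {f \<in> T. f \<inter> e = {}}"
  define Near where "Near = {f \<in> T. f \<inter> e \<noteq> {}}"
  have "e \<noteq> {}" using assms(2) assms(4)[OF less.prems(2)] by auto
  have "2 ^ m * card (spoilt_by e V Far) \<le> 2 ^ card e * card (spoilt_by e V Far)"
    using assms(4)[OF less.prems(2)] by (simp add: power_increasing)
  also have "\<dots> = 2 * card (proper_colourings V Far)"
    using assms(1) assms(3)[OF less.prems(2)] \<open>e \<noteq> {}\<close>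
    by (intro card_spoilt_by_disjoint) (auto simp: Far_def)
  finally have far: "2 ^ m * card (spoilt_by e V Far) \<le> 2 * card (proper_colourings V Far)" .
  have le: "card (spoilt_by e V T) \<le> card (spoilt_by e V Far)"
    by (intro card_mono finite_spoilt_by assms(1) spoilt_by_antimono) (auto simp: Far_def)
  have "card (proper_colourings V Far) \<le> 2 * card (proper_colourings V T)"
  proof -
    have "proper_colourings V Far \<subseteq> proper_colourings V T \<union> (\<Union>f\<in>Near. spoilt_by f V Far)"
      by (auto simp: proper_colourings_def spoilt_by_def Near_def Far_def)
    then have "card (proper_colourings V Far)
        \<le> card (proper_colourings V T \<union> (\<Union>f\<in>Near. spoilt_by f V Far))"
      using finT assms(1)
      by (intro card_mono) (auto simp: finite_proper_colourings finite_spoilt_by Near_def)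
    also have "\<dots> \<le> card (proper_colourings V T) + card (\<Union>f\<in>Near. spoilt_by f V Far)"
      by (rule card_Un_le)
    also have "\<dots> \<le> card (proper_colourings V T) + (\<Sum>f\<in>Near. card (spoilt_by f V Far))"
      using finT by (simp add: card_UN_le Near_def)
    finally have 1: "card (proper_colourings V Far)
        \<le> card (proper_colourings V T) + (\<Sum>f\<in>Near. card (spoilt_by f V Far))" .
    \<comment> \<open>A near edge does not belong to \<open>Far\<close>, so the induction hypothesis applies to \<open>Far\<close>.\<close>
    have IH: "2 ^ m * card (spoilt_by f V Far) \<le> 4 * card (proper_colourings V Far)"
      if "f \<in> Near" for f
    proof (rule less.hyps)
      have "Far \<subset> T" using that by (auto simp: Far_def Near_def)
      then show "card Far < card T" using finT by (rule psubset_card_mono[rotated])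
    qed (use that less.prems in \<open>auto simp: Far_def Near_def\<close>)
    have "2 * 2 ^ m * (\<Sum>f\<in>Near. card (spoilt_by f V Far))
        = 2 * (\<Sum>f\<in>Near. 2 ^ m * card (spoilt_by f V Far))"
      by (simp add: sum_distrib_left mult.assoc)
    also have "\<dots> \<le> 2 * (\<Sum>f\<in>Near. 4 * card (proper_colourings V Far))"
      by (intro mult_left_mono sum_mono IH) auto
    also have "\<dots> = 8 * card Near * card (proper_colourings V Far)" by simp
    also have "\<dots> \<le> 8 * card {f \<in> H. f \<inter> e \<noteq> {}} * card (proper_colourings V Far)"
      using less.prems finH by (intro mult_right_mono mult_left_mono card_mono) (auto simp: Near_def)
    also have "\<dots> \<le> 2 ^ m * card (proper_colourings V Far)"
      using assms(5)[OF less.prems(2)] by (intro mult_right_mono) auto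
    finally have "2 * (\<Sum>f\<in>Near. card (spoilt_by f V Far)) \<le> card (proper_colourings V Far)"
      by simp
    with 1 show ?thesis by simp
  qed
  moreover have "2 ^ m * card (spoilt_by e V T) \<le> 2 ^ m * card (spoilt_by e V Far)"
    using le by simp
  ultimately show ?case using far by linarith
qed

text \<open>
  Adding the edges one at a time, each new edge destroys at most half of the colourings that are still
  proper, so some colouring survives. An edge meets itself, so the sparsity condition forces
  \<open>8 \<le> 2 ^ m\<close>, which is what turns the fraction \<open>4 / 2 ^ m\<close> into one half.
\<close>

lemma finite_hypergraph_two_colourable:
  fixes H :: "'i set set"
  assumes "finite H" "\<And>e. e \<in> H \<Longrightarrow> finite e" "m \<ge> 1" "\<And>e. e \<in> H \<Longrightarrow> m \<le> card e"
    and sparse: "\<And>e. e \<in> H \<Longrightarrow> 8 * card {f \<in> H. f \<inter> e \<noteq> {}} \<le> 2 ^ m"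
  shows "\<exists>S. \<forall>e\<in>H. \<not> monochromatic S e"
proof -
  define V where "V = \<Union>H"
  have V: "finite V" "\<And>e. e \<in> H \<Longrightarrow> e \<subseteq> V" using assms by (auto simp: V_def)
  have "0 < card (proper_colourings V T)" if "T \<subseteq> H" for T
    using finite_subset[OF that assms(1)] that
  proof (induction T rule: finite_induct)
    case empty
    show ?case using V by (simp add: proper_colourings_def card_Pow flip: Pow_def)
  next
    case (insert e T)
    have e: "e \<in> H" using insert.prems by auto
    have "e \<noteq> {}" using assms(3) assms(4)[OF e] by auto
    then have "0 < card {f \<in> H. f \<inter> e \<noteq> {}}"
      using e assms(1) by (auto simp: card_gt_0_iff)
    then have "8 \<le> (2 ^ m :: nat)" using sparse[OF e] by linarith
    then have "8 * card (spoilt_by e V T) \<le> 2 ^ m * card (spoilt_by e V T)" by simp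
    also have "\<dots> \<le> 4 * card (proper_colourings V T)"
      using insert.prems by (intro spoilt_by_bound[of V m H]) (use V assms in auto)
    finally have "card (spoilt_by e V T) < card (proper_colourings V T)"
      using insert by auto
    then have "\<not> proper_colourings V T \<subseteq> spoilt_by e V T"
      using card_mono[OF finite_spoilt_by[OF V(1)]] by (metis not_less)
    then have "proper_colourings V (insert e T) \<noteq> {}"
      by (auto simp: proper_colourings_def spoilt_by_def)
    then show ?case using finite_proper_colourings[OF V(1)] by (simp add: card_gt_0_iff)
  qed
  then have "proper_colourings V H \<noteq> {}" by fastforce
  then show ?thesis by (auto simp: proper_colourings_def)
qed

text \<open>
  In the compact space of all colourings, with the product topology, the colourings that are proper at
  one finite edge form a closed set, because only finitely many coordinates matter. The hypothesis on
  finite subfamilies is the finite intersection property of these sets.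
\<close>

lemma two_colourable_compactness:
  fixes H :: "'i set set"
  assumes fin: "\<And>e. e \<in> H \<Longrightarrow> finite e"
    and sub: "\<And>T. finite T \<Longrightarrow> T \<subseteq> H \<Longrightarrow> \<exists>S. \<forall>e\<in>T. \<not> monochromatic S e"
  shows "\<exists>S. \<forall>e\<in>H. \<not> monochromatic S e"
proof -
  define X where "X = product_topology (\<lambda>_::'i. discrete_topology (UNIV :: bool set)) UNIV"
  have top: "topspace X = UNIV" by (simp add: X_def)
  have comp: "compact_space X"
    by (simp add: X_def compact_space_product_topology compact_space_discrete_topology)
  define good where "good = (\<lambda>e. {c :: 'i \<Rightarrow> bool. \<not> monochromatic {i. c i} e})"
  have cyl: "closedin X {c. c i = b}" for i b
  proof -
    have "continuous_map X (discrete_topology UNIV) (\<lambda>c. c i)"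
      unfolding X_def by (rule continuous_map_product_projection) simp
    from closedin_continuous_map_preimage[OF this, of "{b}"] show ?thesis
      by (simp add: top)
  qed
  have closed: "closedin X (good e)" if "e \<in> H" for e
  proof -
    have "good e = (\<Union>i\<in>e. {c. \<not> c i}) \<inter> (\<Union>i\<in>e. {c. c i})"
      by (auto simp: good_def monochromatic_def)
    also have "closedin X \<dots>"
      using fin[OF that] by (intro closedin_Int closedin_Union) (use cyl[of _ True] cyl[of _ False] in auto)
    finally show ?thesis .
  qed
  have "\<Inter> (good ` H) \<noteq> {}"
  proof -
    have "\<Inter>\<F> \<noteq> {}" if "finite \<F>" "\<F> \<subseteq> good ` H" for \<F>
    proof -
      obtain T where T: "finite T" "T \<subseteq> H" "\<F> = good ` T"
        using finite_subset_image[OF \<open>finite \<F>\<close> \<open>\<F> \<subseteq> good ` H\<close>] by blast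
      then obtain S where "\<forall>e\<in>T. \<not> monochromatic S e" using sub by blast
      then have "(\<lambda>i. i \<in> S) \<in> \<Inter>\<F>" by (simp add: T good_def)
      then show ?thesis by blast
    qed
    then show ?thesis
      using comp[unfolded compact_space_fip, rule_format, of "good ` H"] closed by blast
  qed
  then obtain c where "c \<in> \<Inter> (good ` H)" by blast
  then show ?thesis by (auto simp: good_def)
qed

lemma hypergraph_two_colourable:
  fixes H :: "'i set set"
  assumes "\<And>e. e \<in> H \<Longrightarrow> finite e" "m \<ge> 1" "\<And>e. e \<in> H \<Longrightarrow> m \<le> card e"
    and "\<And>e. e \<in> H \<Longrightarrow> finite {f \<in> H. f \<inter> e \<noteq> {}}"
    and "\<And>e. e \<in> H \<Longrightarrow> 8 * card {f \<in> H. f \<inter> e \<noteq> {}} \<le> 2 ^ m"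
  shows "\<exists>S. \<forall>e\<in>H. \<not> monochromatic S e"
proof (rule two_colourable_compactness)
  fix T assume T: "finite T" "T \<subseteq> H"
  show "\<exists>S. \<forall>e\<in>T. \<not> monochromatic S e"
  proof (rule finite_hypergraph_two_colourable[of _ m])
    fix e assume e: "e \<in> T"
    have "card {f \<in> T. f \<inter> e \<noteq> {}} \<le> card {f \<in> H. f \<inter> e \<noteq> {}}"
      using e T assms(4) by (intro card_mono) auto
    then show "8 * card {f \<in> T. f \<inter> e \<noteq> {}} \<le> 2 ^ m"
      using assms(5)[of e] e T by auto
  qed (use T assms in auto)
qed (use assms in auto)

section \<open>The dual shatter function\<close>

lemma char_vector_eq_iff:
  "char_vector Cs x = char_vector Cs y \<longleftrightarrow> (\<forall>C\<in>set Cs. x \<in> C \<longleftrightarrow> y \<in> C)"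
  by (auto simp: char_vector_def indicator_def)

lemma range_char_vector_subset:
  "range (char_vector Cs) \<subseteq> {w. set w \<subseteq> {0, 1} \<and> length w = length Cs}"
  by (auto simp: char_vector_def indicator_def)

lemma finite_range_char_vector: "finite (range (char_vector Cs))"
  by (rule finite_subset[OF range_char_vector_subset]) (simp add: finite_lists_length_eq)

lemma card_range_char_vector_le: "card (range (char_vector Cs)) \<le> 2 ^ length Cs"
proof -
  have "card (range (char_vector Cs)) \<le> card {w :: nat list. set w \<subseteq> {0, 1} \<and> length w = length Cs}"
    by (intro card_mono range_char_vector_subset) (simp add: finite_lists_length_eq)
  then show ?thesis by (simp add: card_lists_length_eq numeral_2_eq_2)
qed

lemma finite_char_vector_counts:
  "finite {card (range (char_vector Cs)) | Cs. length Cs = n \<and> set Cs \<subseteq> \<C>}"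
  by (rule finite_subset[of _ "{..2 ^ n}"]) (use card_range_char_vector_le in auto)

lemma card_range_char_vector_le_dual_shatter:
  assumes "set Cs \<subseteq> \<C>"
  shows "card (range (char_vector Cs)) \<le> dual_shatter \<C> (length Cs)"
  unfolding dual_shatter_def
  by (rule Max_ge[OF finite_char_vector_counts]) (use assms in blast)

lemma dual_shatter_attained:
  assumes "\<C> \<noteq> {}"
  obtains Cs where "length Cs = n" "set Cs \<subseteq> \<C>" "dual_shatter \<C> n = card (range (char_vector Cs))"
proof -
  obtain C where "C \<in> \<C>" using assms by blast
  then have "length (replicate n C) = n \<and> set (replicate n C) \<subseteq> \<C>" by auto
  then have "{card (range (char_vector Cs)) | Cs. length Cs = n \<and> set Cs \<subseteq> \<C>} \<noteq> {}" by blast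
  from Max_in[OF finite_char_vector_counts this] show ?thesis
    using that unfolding dual_shatter_def by blast
qed

lemma dual_shatter_mono:
  assumes "\<C> \<noteq> {}" "n \<le> n'"
  shows "dual_shatter \<C> n \<le> dual_shatter \<C> n'"
proof -
  obtain Cs where Cs: "length Cs = n" "set Cs \<subseteq> \<C>"
    "dual_shatter \<C> n = card (range (char_vector Cs))"
    using dual_shatter_attained[OF assms(1)] .
  obtain C where "C \<in> \<C>" using assms by blast
  define Cs' where "Cs' = Cs @ replicate (n' - n) C"
  have Cs': "length Cs' = n'" "set Cs' \<subseteq> \<C>" using Cs \<open>C \<in> \<C>\<close> assms by (auto simp: Cs'_def)
  have "range (char_vector Cs) = take n ` range (char_vector Cs')"
    using Cs(1) by (force simp: Cs'_def char_vector_def image_image)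
  then have "card (range (char_vector Cs)) \<le> card (range (char_vector Cs'))"
    by (simp add: card_image_le finite_range_char_vector)
  also have "\<dots> \<le> dual_shatter \<C> n'"
    using card_range_char_vector_le_dual_shatter[OF Cs'(2)] Cs'(1) by simp
  finally show ?thesis using Cs(3) by simp
qed

text \<open>
  A member of a tuple is a union of atoms, the atoms being the classes of points with equal
  characteristic vectors. Hence \<open>k\<close> atoms allow at most \<open>2 ^ k\<close> distinct members. For an infinite
  class this makes the dual shatter function unbounded, and the inverse is then a genuine maximum.
\<close>

lemma le_two_power_dual_shatter:
  assumes "infinite \<C>"
  shows "n \<le> 2 ^ dual_shatter \<C> n"
proof -
  obtain A where A: "finite A" "card A = n" "A \<subseteq> \<C>"
    using infinite_arbitrarily_large[OF assms] by blast
  obtain Cs where Cs: "set Cs = A" "distinct Cs" using finite_distinct_list[OF A(1)] by blast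
  have len: "length Cs = n" using Cs A distinct_card by metis
  have inj: "inj_on (\<lambda>C. char_vector Cs ` C) A"
  proof (rule inj_on_inverseI)
    fix C assume "C \<in> A"
    then show "{x. char_vector Cs x \<in> char_vector Cs ` C} = C"
      using Cs by (auto simp: image_iff char_vector_eq_iff)
  qed
  have "n = card ((\<lambda>C. char_vector Cs ` C) ` A)" using card_image[OF inj] A by simp
  also have "\<dots> \<le> card (Pow (range (char_vector Cs)))"
    by (intro card_mono) (auto simp: finite_range_char_vector)
  also have "\<dots> = 2 ^ card (range (char_vector Cs))"
    by (simp add: card_Pow finite_range_char_vector)
  also have "\<dots> \<le> 2 ^ dual_shatter \<C> n"
    using card_range_char_vector_le_dual_shatter[of Cs \<C>] Cs A len by (intro power_increasing) auto
  finally show ?thesis .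
qed

lemma dual_shatter_shatter_inverse_le:
  assumes "infinite \<C>" "z \<ge> 1"
  shows "real (dual_shatter \<C> (shatter_inverse (dual_shatter \<C>) z)) \<le> z"
proof -
  have ne: "\<exists>n. real (dual_shatter \<C> n) \<le> z"
    using assms dual_shatter_0[of \<C>] by (intro exI[of _ 0]) simp
  have "{n. real (dual_shatter \<C> n) \<le> z} \<subseteq> {..2 ^ nat \<lfloor>z\<rfloor>}"
  proof
    fix n assume "n \<in> {n. real (dual_shatter \<C> n) \<le> z}"
    then have "dual_shatter \<C> n \<le> nat \<lfloor>z\<rfloor>" by (simp add: le_nat_floor)
    then have "(2::nat) ^ dual_shatter \<C> n \<le> 2 ^ nat \<lfloor>z\<rfloor>" by (intro power_increasing) auto
    then show "n \<in> {..2 ^ nat \<lfloor>z\<rfloor>}"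
      using le_two_power_dual_shatter[OF assms(1), of n] by (auto intro: order_trans)
  qed
  then have "finite {n. real (dual_shatter \<C> n) \<le> z}" by (rule finite_subset) simp
  then show ?thesis
    using Max_in[of "{n. real (dual_shatter \<C> n) \<le> z}"] ne by (auto simp: shatter_inverse_def)
qed

section \<open>Packing\<close>

text \<open>
  Double counting: integrate the number of sets containing \<open>x\<close> over \<open>x \<in> B\<close>.
\<close>

lemma sum_measure_le_of_multiplicity:
  fixes F :: "'i \<Rightarrow> 'a::euclidean_space set"
  assumes "finite J" "\<And>i. i \<in> J \<Longrightarrow> F i \<in> sets lborel" "\<And>i. i \<in> J \<Longrightarrow> F i \<subseteq> B"
    and B: "compact B"
    and mult: "\<And>x. real (card {i \<in> J. x \<in> F i}) \<le> K"
  shows "(\<Sum>i\<in>J. measure lborel (F i)) \<le> K * measure lborel B"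
proof -
  have Bm: "B \<in> sets lborel" "emeasure lborel B < \<infinity>"
    using B emeasure_bounded_finite[OF compact_imp_bounded[OF B]] by (auto simp: compact_imp_closed)
  have Fm: "emeasure lborel (F i) < \<infinity>" if "i \<in> J" for i
    using emeasure_mono[OF assms(3)[OF that] Bm(1)] Bm(2) by (rule le_less_trans)
  have int: "integrable lborel (indicator (F i) :: 'a \<Rightarrow> real)" if "i \<in> J" for i
    using assms(2)[OF that] Fm[OF that] by simp
  have "(\<Sum>i\<in>J. measure lborel (F i)) = (\<Sum>i\<in>J. \<integral>x. indicator (F i) x \<partial>lborel)"
    by simp
  also have "\<dots> = (\<integral>x. (\<Sum>i\<in>J. indicator (F i) x) \<partial>lborel)"
    using int by (intro Bochner_Integration.integral_sum[symmetric])
  also have "\<dots> \<le> (\<integral>x. K * indicator B x \<partial>lborel)"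
  proof (rule integral_mono)
    fix x :: 'a
    have "(\<Sum>i\<in>J. indicator (F i) x) = real (card {i \<in> J. x \<in> F i})"
      using assms(1) by (simp add: indicator_def sum.If_cases Int_def)
    also have "\<dots> \<le> K * indicator B x"
    proof (cases "x \<in> B")
      case False
      then have "{i \<in> J. x \<in> F i} = {}" using assms(3) by blast
      then have "card {i \<in> J. x \<in> F i} = 0" by (simp only: card.empty)
      then show ?thesis using False by simp
    qed (use mult in simp)
    finally show "(\<Sum>i\<in>J. indicator (F i) x) \<le> K * indicator B x" .
  qed (use int Bm in auto)
  also have "\<dots> = K * measure lborel B" by simp
  finally show ?thesis .
qed

text \<open>
  The finiteness of \<open>J\<close> is part of the conclusion: the volume comparison bounds the size of every
  finite subset of \<open>J\<close> by the same number \<open>N\<close>.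
\<close>

lemma finite_card_le_of_packing:
  fixes F :: "'i \<Rightarrow> 'a::euclidean_space set"
  assumes "\<And>i. i \<in> J \<Longrightarrow> F i \<in> sets lborel" "\<And>i. i \<in> J \<Longrightarrow> F i \<subseteq> B" "compact B"
    and fin: "\<And>x. finite {i \<in> J. x \<in> F i}"
    and mult: "\<And>x. real (card {i \<in> J. x \<in> F i}) \<le> K"
    and v: "v > 0" "\<And>i. i \<in> J \<Longrightarrow> v \<le> measure lborel (F i)"
    and N: "K * measure lborel B \<le> v * real N"
  shows "finite J \<and> card J \<le> N"
proof (rule finite_if_finite_subsets_card_bdd)
  fix A assume A: "A \<subseteq> J" "finite A"
  have "real (card {i \<in> A. x \<in> F i}) \<le> K" for x
  proof -
    have "card {i \<in> A. x \<in> F i} \<le> card {i \<in> J. x \<in> F i}"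
      using A fin by (intro card_mono) auto
    then show ?thesis using mult[of x] by simp
  qed
  then have "(\<Sum>i\<in>A. measure lborel (F i)) \<le> K * measure lborel B"
    using A assms(1-3) by (intro sum_measure_le_of_multiplicity) blast+
  moreover have "real (card A) * v \<le> (\<Sum>i\<in>A. measure lborel (F i))"
    using A by (intro sum_bounded_below v(2)) auto
  ultimately have "v * real (card A) \<le> v * real N" using N by (simp add: mult.commute)
  then show "card A \<le> N" using v(1) by simp
qed

section \<open>Splitting the covering\<close>

theorem theorem8p2:
  fixes \<C> :: "(real ^ 'd) set set" and D v :: real and m :: nat
    and I :: "'i set" and F :: "'i \<Rightarrow> (real ^ 'd) set"
  assumes "v > 0"
    and "\<And>C. C \<in> \<C> \<Longrightarrow> open C"
    and "\<And>C. C \<in> \<C> \<Longrightarrow> bounded C \<and> diameter C \<le> D"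
    and "\<And>C. C \<in> \<C> \<Longrightarrow> v \<le> measure lborel C"
    and "m \<ge> 1"
    and "\<And>i. i \<in> I \<Longrightarrow> F i \<in> \<C>"
    and "fold_covering m I F"
    and "\<not> (\<exists>x. covered_more_than
           (v / ((2 * D) ^ CARD('d) * measure lborel (cball (0 :: real ^ 'd) 1))
              * real (shatter_inverse (dual_shatter \<C>) (2 powi (int m - 3)))) I F x)"
  shows "splits_into_two_coverings I F"
proof -
  define E where "E = (\<lambda>x. {i \<in> I. x \<in> F i})"
  define z :: real where "z = 2 powi (int m - 3)"
  define N where "N = shatter_inverse (dual_shatter \<C>) z"
  define K where "K = v / ((2 * D) ^ CARD('d) * measure lborel (cball (0 :: real ^ 'd) 1)) * real N"
  have finE: "finite (E x)" and cardE: "real (card (E x)) \<le> K" for x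
    using assms(8) by (auto simp: covered_more_than_def E_def K_def N_def z_def not_less)
  have mE: "m \<le> card (E x)" for x
    using assms(7) finE[of x] unfolding fold_covering_def E_def by auto
  then have neE: "E x \<noteq> {}" for x using assms(5) by (metis card.empty not_one_le_zero order_trans)
  have dist_le: "dist x y \<le> D" if "C \<in> \<C>" "x \<in> C" "y \<in> C" for C x y
    using diameter_bounded_bound[of C x y] assms(3)[OF that(1)] that by auto
  have infC: "infinite \<C>"
  proof
    assume "finite \<C>"
    then have "bounded (\<Union>\<C>)" using assms(3) by (intro bounded_Union) auto
    moreover have "\<Union>\<C> = UNIV" using neE assms(6) unfolding E_def by blast
    ultimately show False by simp
  qed
  have "D > 0"
  proof (rule ccontr)
    assume "\<not> D > 0"
    obtain i where i: "i \<in> I" "0 \<in> F i" using neE[of 0] unfolding E_def by blast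
    then have "F i \<subseteq> {0}" using dist_le[OF assms(6)[OF i(1)], of 0] \<open>\<not> D > 0\<close>
      by (smt (verit) dist_le_zero_iff singletonI subsetI)
    then have "F i = {0}" using i by auto
    then have "measure lborel (F i) = 0" by (simp add: measure_def)
    then show False using assms(4)[OF assms(6)[OF i(1)]] assms(1) by simp
  qed
  have vol: "K * measure lborel (cball x (2 * D)) = v * real N" for x :: "real ^ 'd"
  proof -
    have "measure lborel (cball x (2 * D))
        = (2 * D) ^ CARD('d) * measure lborel (cball (0 :: real ^ 'd) 1)"
      using \<open>D > 0\<close> by (simp add: content_cball)
    moreover have "measure lborel (cball (0 :: real ^ 'd) 1) > 0" by (rule content_cball_pos) simp
    ultimately show ?thesis using \<open>D > 0\<close> by (simp add: K_def)
  qed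
  \<comment> \<open>If \<open>z < 1 = dual_shatter \<C> 0\<close>, then the inverse takes its default value 0 and the multiplicity
      bound would leave every point uncovered.\<close>
  have "z \<ge> 1"
  proof (rule ccontr)
    assume "\<not> z \<ge> 1"
    have "real (dual_shatter \<C> n) > z" for n
      using dual_shatter_mono[of \<C> 0 n] infC dual_shatter_0[of \<C>] \<open>\<not> z \<ge> 1\<close> by fastforce
    then have "\<not> (\<exists>n. real (dual_shatter \<C> n) \<le> z)" by (simp add: not_le)
    then have "N = 0" by (simp add: N_def shatter_inverse_def)
    then have "card (E 0) = 0" using cardE[of 0] by (simp add: K_def)
    then show False using mE[of 0] assms(5) by simp
  qed
  then have piN: "real (dual_shatter \<C> N) \<le> z"
    unfolding N_def by (rule dual_shatter_shatter_inverse_le[OF infC])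
  have eightz: "8 * z = 2 ^ m" unfolding z_def by (simp add: power_int_diff)
  have near: "finite {f \<in> range E. f \<inter> E x \<noteq> {}} \<and> 8 * card {f \<in> range E. f \<inter> E x \<noteq> {}} \<le> 2 ^ m"
    for x
  proof -
    define J where "J = {i \<in> I. F i \<subseteq> cball x (2 * D)}"
    have "finite J \<and> card J \<le> N"
    proof (rule finite_card_le_of_packing)
      show "compact (cball x (2 * D))" by simp
      show "finite {i \<in> J. y \<in> F i}" for y
        by (rule finite_subset[OF _ finE[of y]]) (auto simp: J_def E_def)
      show "real (card {i \<in> J. y \<in> F i}) \<le> K" for y
        using card_mono[OF finE[of y], of "{i \<in> J. y \<in> F i}"] cardE[of y]
        by (force simp: J_def E_def)
    qed (use assms vol in \<open>auto simp: J_def\<close>)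
    then obtain js where js: "set js = J" "length js = card J"
      by (metis finite_distinct_list distinct_card)
    define Cs where "Cs = map F js"
    have Cs: "set Cs \<subseteq> \<C>" using js assms(6) by (auto simp: Cs_def J_def)
    have sub: "E y \<subseteq> J" if meet: "E y \<inter> E x \<noteq> {}" for y
    proof
      fix j assume j: "j \<in> E y"
      obtain i where i: "i \<in> I" "y \<in> F i" "x \<in> F i" using meet by (auto simp: E_def)
      have "dist x w \<le> 2 * D" if "w \<in> F j" for w
      proof -
        have "dist x y \<le> D" using dist_le[OF assms(6)] i by blast
        moreover have "dist y w \<le> D" using dist_le[OF assms(6)] j that by (auto simp: E_def)
        ultimately show ?thesis using dist_triangle[of x w y] by linarith
      qed
      then show "j \<in> J" using j by (auto simp: J_def E_def)
    qed
    \<comment> \<open>Only for points all of whose members are listed in \<open>Cs\<close> does the characteristic vector determine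
        the edge, so \<open>decode\<close> has to choose its representative among these points.\<close>
    define decode where "decode = (\<lambda>w. E (SOME y. char_vector Cs y = w \<and> E y \<subseteq> J))"
    have "{f \<in> range E. f \<inter> E x \<noteq> {}} \<subseteq> decode ` range (char_vector Cs)"
    proof clarify
      fix y assume "E y \<inter> E x \<noteq> {}"
      then have y: "E y \<subseteq> J" by (rule sub)
      define y' where "y' = (SOME y'. char_vector Cs y' = char_vector Cs y \<and> E y' \<subseteq> J)"
      have "char_vector Cs y' = char_vector Cs y \<and> E y' \<subseteq> J"
        unfolding y'_def by (rule someI[of _ y]) (use y in blast)
      then have "E y' \<subseteq> J" and "\<And>j. j \<in> J \<Longrightarrow> y' \<in> F j \<longleftrightarrow> y \<in> F j"
        unfolding char_vector_eq_iff Cs_def set_map js by blast+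
      then have "E y' = E y" using y unfolding E_def by blast
      then have "E y = decode (char_vector Cs y)" unfolding decode_def y'_def by (rule sym)
      then show "E y \<in> decode ` range (char_vector Cs)" by blast
    qed
    then have "finite {f \<in> range E. f \<inter> E x \<noteq> {}}"
      and "card {f \<in> range E. f \<inter> E x \<noteq> {}} \<le> card (range (char_vector Cs))"
      by (simp_all add: finite_subset finite_range_char_vector surj_card_le)
    moreover have "card (range (char_vector Cs)) \<le> dual_shatter \<C> (card J)"
      using card_range_char_vector_le_dual_shatter[OF Cs] js by (simp add: Cs_def)
    moreover have "dual_shatter \<C> (card J) \<le> dual_shatter \<C> N"
      using \<open>finite J \<and> card J \<le> N\<close> infC by (intro dual_shatter_mono) auto
    ultimately have "finite {f \<in> range E. f \<inter> E x \<noteq> {}}"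
      and "real (8 * card {f \<in> range E. f \<inter> E x \<noteq> {}}) \<le> 8 * z"
      using piN by auto
    then have "real (8 * card {f \<in> range E. f \<inter> E x \<noteq> {}}) \<le> real (2 ^ m)"
      using eightz by simp
    then have "8 * card {f \<in> range E. f \<inter> E x \<noteq> {}} \<le> 2 ^ m" by (rule of_nat_le_iff[THEN iffD1])
    with \<open>finite {f \<in> range E. f \<inter> E x \<noteq> {}}\<close> show ?thesis by blast
  qed
  have "\<exists>S. \<forall>e\<in>range E. \<not> monochromatic S e"
    by (rule hypergraph_two_colourable[of _ m]) (use finE mE near assms(5) in auto)
  then obtain S where S: "\<And>x. \<not> monochromatic S (E x)" by blast
  have cov: "covering I' F" if meets: "\<And>x. E x \<inter> I' \<noteq> {}" and "I' \<subseteq> I" for I'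
    unfolding fold_covering_def
  proof
    fix x
    have "{i \<in> I'. x \<in> F i} = E x \<inter> I'" using \<open>I' \<subseteq> I\<close> by (auto simp: E_def)
    moreover have "card (E x \<inter> I') > 0" using meets finE by (simp add: card_gt_0_iff)
    ultimately show "infinite {i \<in> I'. x \<in> F i} \<or> 1 \<le> card {i \<in> I'. x \<in> F i}" by simp
  qed
  have "E x \<subseteq> I" for x by (auto simp: E_def)
  then have "E x \<inter> (I \<inter> S) \<noteq> {}" "E x \<inter> (I - S) \<noteq> {}" for x
    using S[of x] unfolding monochromatic_def by blast+
  then have "covering (I \<inter> S) F" "covering (I - S) F" by (intro cov; blast)+
  then show ?thesis
    unfolding splits_into_two_coverings_def by (intro exI[of _ "I \<inter> S"] exI[of _ "I - S"]) auto
qed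

end
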